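(* Assume that $K$ is a p.c.f. self-similar set. For $1<p<\infty$ and $f\in L^p(K,\mu)$, we have $$\int_K [M_{\mathcal{D}}^\mu f(x)]^p\, d\mu\le \frac{2^{p+2}p}{p-1}\int_K |f(x)|^p\, d\mu.$$
   Context: Self-similar set and measure. For $1\le i\le m$ let $S_i:\mathbb{R}^d\to\mathbb{R}^d$, $S_i(x)=r_iR_i(x)+b_i$ with $0<r_i<1$, $b_i\in\mathbb{R}^d$, $R_i$ orthogonal. $K\subset\mathbb{R}^d$ is the unique nonempty compact set with $K=\bigcup_{i=1}^m S_i(K)$ (the self-similar set generated by $\{S_i\}_{i=1}^m$). It is always assumed that the $S_i$ do not all share a common fixed point. Given a probability vector $(p_1,\dots,p_m)$ with all $p_i>0$ and $\sum_i p_i=1$, $\mu$ is the unique Borel probability measure with $\mu=\sum_{i=1}^m p_i\,\mu\circ S_i^{-1}$ (self-similar measure; it is supported on $K$). Basic cubes. $\Sigma_n=\{1,\dots,m\}^n$ for $n\ge1$. For $\mathbf{i}=i_1\ldots i_n$, $S_{\mathbf{i}}=S_{i_1}\circ\cdots\circ S_{i_n}$ and $K_{\mathbf{i}}=S_{\mathbf{i}}(K)$. $\mathcal{D}$ is the collection consisting of $K$ and all $K_{\mathbf{i}}$, $\mathbf{i}\in\Sigma_n$, $n\ge1$ (basic cubes). P.c.f. Let $\Sigma_\infty=\{1,\dots,m\}^{\mathbb{N}}$, let $\Pi:\Sigma_\infty\to K$ be the coding map, $\{\Pi(\mathbf{i})\}=\bigcap_{n\ge1}K_{i_1\ldots i_n}$,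 and let $\sigma$ be the shift $\sigma(i_1,i_2,\dots)=(i_2,i_3,\dots)$. Put $\mathcal{C}_K=\bigcup_{i\ne j}(S_i(K)\cap S_j(K))$ and $\mathcal{C}=\Pi^{-1}(\mathcal{C}_K)$. $K$ is post-critically finite (p.c.f.) if $\bigcup_{n\ge1}\sigma^n(\mathcal{C})$ is a finite set. Maximal operator. $M_{\mathcal{D}}^\mu f(x)=\sup\frac{1}{\mu(K_{\mathbf{i}})}\int_{K_{\mathbf{i}}}|f|\,d\mu$ for $x\in K$, the supremum being over all $n\in\mathbb{N}=\{1,2,\dots\}$ and all $\mathbf{i}\in\Sigma_n$ with $x\in K_{\mathbf{i}}$. *)

theory Defs
  imports "HOL-Probability.Probability" "HOL-Library.Stream"
begin

definition self_similar_set :: "nat \<Rightarrow> (nat \<Rightarrow> 'a \<Rightarrow> 'a::topological_space) \<Rightarrow> 'a set \<Rightarrow> bool" where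
  "self_similar_set m S K \<longleftrightarrow> K \<noteq> {} \<and> compact K \<and> K = (\<Union>i\<in>{1..m}. S i ` K)"

definition self_similar_measure ::
    "nat \<Rightarrow> (nat \<Rightarrow> 'a \<Rightarrow> 'a::topological_space) \<Rightarrow> (nat \<Rightarrow> real) \<Rightarrow> 'a measure \<Rightarrow> bool" where
  "self_similar_measure m S w \<mu> \<longleftrightarrow>
     sets \<mu> = sets borel \<and> prob_space \<mu> \<and>
     (\<forall>A\<in>sets borel. emeasure \<mu> A = (\<Sum>i=1..m. ennreal (w i) * emeasure \<mu> (S i -` A)))"

definition words :: "nat \<Rightarrow> nat \<Rightarrow> nat list set" where
  "words m n = {u. length u = n \<and> set u \<subseteq> {1..m}}"

definition word_map :: "(nat \<Rightarrow> 'a \<Rightarrow> 'a) \<Rightarrow> nat list \<Rightarrow> 'a \<Rightarrow> 'a" where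
  "word_map S u = foldr (\<circ>) (map S u) id"

definition basic_cube :: "(nat \<Rightarrow> 'a \<Rightarrow> 'a) \<Rightarrow> 'a set \<Rightarrow> nat list \<Rightarrow> 'a set" where
  "basic_cube S K u = word_map S u ` K"

text \<open>Infinite words are streams over \<open>{1..m}\<close>; the shift is \<^const>\<open>stl\<close>.\<close>

definition coding_map :: "(nat \<Rightarrow> 'a \<Rightarrow> 'a) \<Rightarrow> 'a set \<Rightarrow> nat stream \<Rightarrow> 'a" where
  "coding_map S K \<omega> = the_elem (\<Inter>n\<in>{1..}. basic_cube S K (stake n \<omega>))"

definition critical_points :: "nat \<Rightarrow> (nat \<Rightarrow> 'a \<Rightarrow> 'a) \<Rightarrow> 'a set \<Rightarrow> 'a set" where
  "critical_points m S K = (\<Union>i\<in>{1..m}. \<Union>j\<in>{1..m} - {i}. S i ` K \<inter> S j ` K)"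

definition critical_set :: "nat \<Rightarrow> (nat \<Rightarrow> 'a \<Rightarrow> 'a) \<Rightarrow> 'a set \<Rightarrow> nat stream set" where
  "critical_set m S K = {\<omega> \<in> streams {1..m}. coding_map S K \<omega> \<in> critical_points m S K}"

definition post_critically_finite :: "nat \<Rightarrow> (nat \<Rightarrow> 'a \<Rightarrow> 'a) \<Rightarrow> 'a set \<Rightarrow> bool" where
  "post_critically_finite m S K \<longleftrightarrow> finite (\<Union>n\<in>{1..}. (stl ^^ n) ` critical_set m S K)"

definition Lp_on :: "real \<Rightarrow> 'a set \<Rightarrow> 'a measure \<Rightarrow> ('a \<Rightarrow> real) set" where
  "Lp_on p K \<mu> = {f. set_borel_measurable \<mu> K f \<and> set_integrable \<mu> K (\<lambda>x. \<bar>f x\<bar> powr p)}"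

text \<open>The supremum is taken in \<open>[0, \<infinity>]\<close>, so it may be infinite at some points.\<close>

definition cube_maximal ::
    "nat \<Rightarrow> (nat \<Rightarrow> 'a \<Rightarrow> 'a) \<Rightarrow> 'a set \<Rightarrow> 'a measure \<Rightarrow> ('a \<Rightarrow> real) \<Rightarrow> 'a \<Rightarrow> ennreal" where
  "cube_maximal m S K \<mu> f x =
     (SUP u \<in> {u. (\<exists>n\<ge>1. u \<in> words m n) \<and> x \<in> basic_cube S K u}.
        (\<integral>\<^sup>+y\<in>basic_cube S K u. ennreal \<bar>f y\<bar> \<partial>\<mu>) / emeasure \<mu> (basic_cube S K u))"

text \<open>Real powers on \<open>[0, \<infinity>]\<close>, used for positive exponents only. The case split is needed
  because \<^const>\<open>enn2real\<close> sends \<open>\<infinity>\<close> to \<open>0\<close>.\<close>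

definition ennreal_powr :: "ennreal \<Rightarrow> real \<Rightarrow> ennreal" where
  "ennreal_powr x p = (if x = \<top> then \<top> else ennreal (enn2real x powr p))"

end

theory Submission
  imports Defs "HOL-Library.Sublist"
begin

text \<open>
  Up to null sets the basic cubes of a post-critically finite set behave like dyadic cubes, so
  the maximal operator is a dyadic (martingale) maximal operator and satisfies Doob's estimates.

  Two facts give the dyadic structure. First, the critical points are finite in number
  (\<open>finite_critical_points\<close>): the shift is at most \<open>m\<close>-to-one on words over \<open>m\<close> letters, so
  finiteness of the post-critical set makes the critical set finite, and the coding map sends it
  onto the critical points. Injectivity of the maps then makes the intersection of any
  two cubes with incomparable words finite. Second, \<open>\<mu>\<close> has no atoms
  (\<open>self_similar_measure_atomless\<close>): the finitely many atoms of maximal mass would be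
  permuted by every \<open>S i\<close>, hence reduce to one point, which all \<open>S i\<close> would fix. So two
  cubes are nested, or they meet in a null set.

  For such a family the weak-type estimate
  \<open>t * \<mu> {M f > t} \<le> \<integral> over {M f > t} of |f|\<close> holds with constant \<open>1\<close>: the level set is a union
  of cubes with average above \<open>t\<close>, and those among them whose word extends no other of these words
  already cover it and are almost disjoint (\<open>nested_family_weak_type\<close>). Integrating
  over the levels \<open>t\<close>, after discarding the part of \<open>f\<close> below \<open>t / 2\<close>, gives the strong-type
  estimate with constant \<open>2 powr p * p / (p - 1)\<close> (\<open>strong_type_from_weak_type\<close>), a quarter of
  the constant asserted.
\<close>

section \<open>From weak type to strong type\<close>

lemma nn_integral_powr_below:
  fixes a c :: real
  assumes "-1 < a" "0 \<le> c"
  shows "(\<integral>\<^sup>+t. ennreal (t powr a) * indicator {0<..<c} t \<partial>lborel) = ennreal (c powr (a + 1) / (a + 1))"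
proof -
  have "((\<lambda>t. t powr a) has_integral (c powr (a + 1) / (a + 1))) {0<..<c}"
    using has_integral_powr_from_0[OF assms]
    by (subst has_integral_Icc_iff_Ioo[symmetric])
  then show ?thesis
    by (rule nn_integral_has_integral_lebesgue'[rotated]) simp
qed

text \<open>
  This is in fact an equality; the inequality is what bounding the \<open>p\<close>-th moment of a maximal
  function by its level sets requires. The value \<open>\<top>\<close> has to be treated separately,
  because \<^const>\<open>ennreal_powr\<close> is defined by cases there; the integral then exceeds every natural
  number.
\<close>

lemma ennreal_powr_le_layer_cake:
  assumes p: "1 < p"
  shows "ennreal_powr y p \<le> (\<integral>\<^sup>+t. ennreal (p * t powr (p - 1)) * indicator {t. 0 < t \<and> ennreal t < y} t \<partial>lborel)"
    (is "_ \<le> ?I y")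
proof -
  have base: "?I (ennreal c) = ennreal (c powr p)" if "0 \<le> c" for c
  proof -
    have "{t. 0 < t \<and> ennreal t < ennreal c} = {0<..<c}"
      using that by (auto simp: ennreal_less_iff)
    moreover have "(\<integral>\<^sup>+t. ennreal (p * t powr (p - 1)) * indicator {0<..<c} t \<partial>lborel)
        = ennreal p * (\<integral>\<^sup>+t. ennreal (t powr (p - 1)) * indicator {0<..<c} t \<partial>lborel)"
      using p by (subst nn_integral_cmult[symmetric]) (auto simp: ennreal_mult mult.assoc)
    ultimately show ?thesis
      using p that nn_integral_powr_below[of "p - 1" c] by (simp add: ennreal_mult'[symmetric])
  qed
  show ?thesis
  proof (cases "y = \<top>")
    case False
    then obtain c where "0 \<le> c" "y = ennreal c" by (cases y) auto
    then show ?thesis using base[of c] by (simp add: ennreal_powr_def)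
  next
    case True
    have "?I \<top> \<ge> of_nat n" for n
    proof -
      define c where "c = real n powr (1 / p)"
      have "ennreal (c powr p) \<le> ?I \<top>"
        unfolding base[of c, symmetric, OF powr_ge_zero[of "real n" "1/p", folded c_def]]
        by (intro nn_integral_mono) (auto simp: indicator_def)
      moreover have "c powr p = real n" using p by (simp add: c_def powr_powr)
      ultimately show ?thesis by (simp add: ennreal_of_nat_eq_real_of_nat)
    qed
    then have "(SUP n. of_nat n) \<le> ?I \<top>" by (rule SUP_least)
    then have "?I \<top> = \<top>" by (simp add: ennreal_SUP_of_nat_eq_top top_unique)
    then show ?thesis using True by simp
  qed
qed

text \<open>
  On \<open>{F > t}\<close> the part of \<open>g\<close> that is at most \<open>t / 2\<close> contributes at most
  \<open>t / 2\<close> times the measure of that set, and finiteness of the measure allows this to be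
  absorbed into the left-hand side. After the truncation the integral over \<open>t\<close> of the right-hand
  side can be computed explicitly, since \<open>F\<close> no longer occurs in it.
\<close>

lemma (in finite_measure) weak_type_truncated:
  fixes F :: "'a \<Rightarrow> ennreal" and g :: "'a \<Rightarrow> real"
  assumes [measurable]: "F \<in> borel_measurable M" "g \<in> borel_measurable M"
    and t: "0 < t"
    and weak: "ennreal t * emeasure M {x\<in>space M. ennreal t < F x}
                 \<le> (\<integral>\<^sup>+x\<in>{x\<in>space M. ennreal t < F x}. ennreal (g x) \<partial>M)"
  shows "ennreal (t / 2) * emeasure M {x\<in>space M. ennreal t < F x}
           \<le> (\<integral>\<^sup>+x. ennreal (g x) * indicator {x. t < 2 * g x} x \<partial>M)" (is "_ * ?e \<le> ?I")
proof -
  let ?E = "{x\<in>space M. ennreal t < F x}"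
  have half: "ennreal t = ennreal (t / 2) + ennreal (t / 2)"
    using t by (simp add: ennreal_plus[symmetric])
  have "ennreal (t / 2) * ?e + ennreal (t / 2) * ?e = ennreal t * ?e"
    unfolding half by (simp add: distrib_right)
  also note weak
  also have "(\<integral>\<^sup>+x\<in>?E. ennreal (g x) \<partial>M)
      \<le> (\<integral>\<^sup>+x. ennreal (t / 2) * indicator ?E x + ennreal (g x) * indicator {x. t < 2 * g x} x \<partial>M)"
    by (intro nn_integral_mono) (auto simp: indicator_def intro!: ennreal_leI)
  also have "\<dots> = ennreal (t / 2) * ?e + ?I"
    by (subst nn_integral_add) (auto simp: nn_integral_cmult)
  finally show ?thesis
    using emeasure_finite[of ?E] by (auto simp: ennreal_mult_eq_top_iff)
qed

text \<open>
  The layer-cake formula turns the left-hand side into the integral of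
  \<open>p * t powr (p - 1) * M {F > t}\<close> over \<open>t > 0\<close>. Insert the truncated weak-type estimate and
  exchange the integrals: at a point \<open>x\<close> there remains \<open>g x\<close> times the integral of
  \<open>2 * p * t powr (p - 2)\<close> over \<open>0 < t < 2 * g x\<close>, which converges at \<open>0\<close> because \<open>p > 1\<close>.
\<close>

lemma (in finite_measure) strong_type_from_weak_type:
  fixes F :: "'a \<Rightarrow> ennreal" and g :: "'a \<Rightarrow> real"
  assumes [measurable]: "F \<in> borel_measurable M" "g \<in> borel_measurable M"
    and g: "\<And>x. 0 \<le> g x" and p: "1 < p"
    and weak: "\<And>t. 0 < t \<Longrightarrow> ennreal t * emeasure M {x\<in>space M. ennreal t < F x}
                 \<le> (\<integral>\<^sup>+x\<in>{x\<in>space M. ennreal t < F x}. ennreal (g x) \<partial>M)"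
  shows "(\<integral>\<^sup>+x. ennreal_powr (F x) p \<partial>M)
           \<le> ennreal (2 powr p * p / (p - 1)) * (\<integral>\<^sup>+x. ennreal (g x powr p) \<partial>M)"
proof -
  interpret pair_sigma_finite M lborel ..
  have "(\<integral>\<^sup>+x. ennreal_powr (F x) p \<partial>M)
      \<le> (\<integral>\<^sup>+x. \<integral>\<^sup>+t. ennreal (p * t powr (p - 1)) * indicator {t. 0 < t \<and> ennreal t < F x} t \<partial>lborel \<partial>M)"
    by (intro nn_integral_mono ennreal_powr_le_layer_cake p)
  also have "\<dots> = (\<integral>\<^sup>+t. \<integral>\<^sup>+x. ennreal (p * t powr (p - 1)) * indicator {t. 0 < t \<and> ennreal t < F x} t \<partial>M \<partial>lborel)"
    by (rule Fubini'[symmetric]) simp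
  also have "\<dots> \<le> (\<integral>\<^sup>+t. \<integral>\<^sup>+x. ennreal (g x) * (ennreal (2 * p * t powr (p - 2)) * indicator {0<..<2 * g x} t) \<partial>M \<partial>lborel)"
  proof (rule nn_integral_mono)
    fix t :: real
    show "(\<integral>\<^sup>+x. ennreal (p * t powr (p - 1)) * indicator {t. 0 < t \<and> ennreal t < F x} t \<partial>M)
        \<le> (\<integral>\<^sup>+x. ennreal (g x) * (ennreal (2 * p * t powr (p - 2)) * indicator {0<..<2 * g x} t) \<partial>M)"
    proof (cases "0 < t")
      case True
      have split: "p * t powr (p - 1) = 2 * p * t powr (p - 2) * (t / 2)"
        using True powr_add[of t "p - 2" 1] by simp
      have "(\<integral>\<^sup>+x. ennreal (p * t powr (p - 1)) * indicator {t. 0 < t \<and> ennreal t < F x} t \<partial>M)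
          = (\<integral>\<^sup>+x. ennreal (p * t powr (p - 1)) * indicator {x\<in>space M. ennreal t < F x} x \<partial>M)"
        using True by (intro nn_integral_cong) (auto simp: indicator_def)
      also have "\<dots> = ennreal (2 * p * t powr (p - 2)) * (ennreal (t / 2) * emeasure M {x\<in>space M. ennreal t < F x})"
        using True p by (simp add: nn_integral_cmult split ennreal_mult mult.assoc del: times_divide_eq_right)
      also have "\<dots> \<le> ennreal (2 * p * t powr (p - 2)) * (\<integral>\<^sup>+x. ennreal (g x) * indicator {x. t < 2 * g x} x \<partial>M)"
        by (intro mult_left_mono weak_type_truncated weak True) auto
      also have "\<dots> = (\<integral>\<^sup>+x. ennreal (2 * p * t powr (p - 2)) * (ennreal (g x) * indicator {x. t < 2 * g x} x) \<partial>M)"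
        by (rule nn_integral_cmult[symmetric]) measurable
      also have "\<dots> = (\<integral>\<^sup>+x. ennreal (g x) * (ennreal (2 * p * t powr (p - 2)) * indicator {0<..<2 * g x} t) \<partial>M)"
        using True by (intro nn_integral_cong) (simp add: indicator_def mult.commute)
      finally show ?thesis .
    qed (auto simp: indicator_def)
  qed
  also have "\<dots> = (\<integral>\<^sup>+x. \<integral>\<^sup>+t. ennreal (g x) * (ennreal (2 * p * t powr (p - 2)) * indicator {0<..<2 * g x} t) \<partial>lborel \<partial>M)"
    unfolding indicator_def greaterThanLessThan_iff by (rule Fubini') simp
  also have "\<dots> = (\<integral>\<^sup>+x. ennreal (2 powr p * p / (p - 1)) * ennreal (g x powr p) \<partial>M)"
  proof (intro nn_integral_cong)
    fix x
    have pw: "g x * g x powr (p - 1) = g x powr p"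
      using g[of x] p powr_add[of "g x" 1 "p - 1"] by (cases "g x = 0") auto
    have pw2: "2 * (2::real) powr (p - 1) = 2 powr p"
      using powr_add[of "2::real" 1 "p - 1"] by simp
    have "(\<integral>\<^sup>+t. ennreal (g x) * (ennreal (2 * p * t powr (p - 2)) * indicator {0<..<2 * g x} t) \<partial>lborel)
        = (\<integral>\<^sup>+t. ennreal (g x * (2 * p)) * (ennreal (t powr (p - 2)) * indicator {0<..<2 * g x} t) \<partial>lborel)"
      using p g[of x] by (intro nn_integral_cong) (simp add: ennreal_mult mult.assoc)
    also have "\<dots> = ennreal (g x * (2 * p)) * ennreal ((2 * g x) powr (p - 1) / (p - 1))"
      using p g[of x] nn_integral_powr_below[of "p - 2" "2 * g x"] by (subst nn_integral_cmult) auto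
    also have "\<dots> = ennreal ((2 * 2 powr (p - 1)) * p / (p - 1) * (g x * g x powr (p - 1)))"
      using p g[of x] by (simp add: ennreal_mult'[symmetric] powr_mult mult_ac)
    also have "\<dots> = ennreal (2 powr p * p / (p - 1)) * ennreal (g x powr p)"
      using p unfolding pw pw2 by (simp add: ennreal_mult'[symmetric])
    finally show "(\<integral>\<^sup>+t. ennreal (g x) * (ennreal (2 * p * t powr (p - 2)) * indicator {0<..<2 * g x} t) \<partial>lborel)
        = ennreal (2 powr p * p / (p - 1)) * ennreal (g x powr p)" .
  qed
  also have "\<dots> = ennreal (2 powr p * p / (p - 1)) * (\<integral>\<^sup>+x. ennreal (g x powr p) \<partial>M)"
    by (rule nn_integral_cmult) simp
  finally show ?thesis .
qed

section \<open>Weak type for nested families\<close>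

text \<open>
  Almost every point lies in at most one of the sets \<open>Q u\<close>, so the sum of their indicators is
  almost everywhere the indicator of the union.
\<close>

lemma nn_integral_UN_almost_disjoint:
  assumes V: "countable V"
    and Q: "\<And>u. u \<in> V \<Longrightarrow> Q u \<in> sets M"
    and null: "\<And>u v. u \<in> V \<Longrightarrow> v \<in> V \<Longrightarrow> u \<noteq> v \<Longrightarrow> emeasure M (Q u \<inter> Q v) = 0"
    and h: "h \<in> borel_measurable M"
  shows "(\<integral>\<^sup>+x\<in>(\<Union>u\<in>V. Q u). h x \<partial>M) = (\<integral>\<^sup>+u. (\<integral>\<^sup>+x\<in>Q u. h x \<partial>M) \<partial>count_space V)"
proof -
  have "AE x in M. x \<notin> Q u \<inter> Q v" if "u \<in> V" "v \<in> V" "u \<noteq> v" for u v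
    using Q null that by (intro AE_I[of _ _ "Q u \<inter> Q v"]) auto
  then have "AE x in M. \<forall>u\<in>V. \<forall>v\<in>V. u \<noteq> v \<longrightarrow> x \<notin> Q u \<inter> Q v"
    by (simp only: AE_ball_countable[OF V]) (auto intro: AE_mp)
  then have "(\<integral>\<^sup>+x\<in>(\<Union>u\<in>V. Q u). h x \<partial>M)
      = (\<integral>\<^sup>+x. (\<integral>\<^sup>+u. h x * indicator (Q u) x \<partial>count_space V) \<partial>M)"
  proof (intro nn_integral_cong_AE, eventually_elim)
    case (elim x)
    show ?case
    proof (cases "x \<in> (\<Union>u\<in>V. Q u)")
      case True
      then obtain u where u: "u \<in> V" "x \<in> Q u" by auto
      have "(\<integral>\<^sup>+v. h x * indicator (Q v) x \<partial>count_space V)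
          = (\<integral>\<^sup>+v. h x * indicator {u} v \<partial>count_space V)"
        using elim u by (intro nn_integral_cong) (auto simp: indicator_def)
      also have "\<dots> = h x"
        using u by (subst nn_integral_cmult_indicator) auto
      finally show ?thesis using True by simp
    qed (auto simp: indicator_def intro!: nn_integral_zero')
  qed
  also have "\<dots> = (\<integral>\<^sup>+u. (\<integral>\<^sup>+x\<in>Q u. h x \<partial>M) \<partial>count_space V)"
    using V Q h by (intro nn_integral_count_space_nn_integral) auto
  finally show ?thesis .
qed

text \<open>
  The covering argument for dyadic cubes. In the application \<open>U\<close> consists of the words whose cube
  has average above \<open>c\<close>. Words without a proper prefix in \<open>U\<close> are pairwise incomparable, and their
  sets still cover the union because \<open>Q\<close> decreases along prefixes.
\<close>

lemma nested_family_weak_type: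
  fixes Q :: "'i::countable list \<Rightarrow> 'a set"
  assumes Q: "\<And>u. u \<in> U \<Longrightarrow> Q u \<in> sets M"
    and nested: "\<And>u v. u \<in> U \<Longrightarrow> v \<in> U \<Longrightarrow> prefix u v \<Longrightarrow> Q v \<subseteq> Q u"
    and null: "\<And>u v. u \<in> U \<Longrightarrow> v \<in> U \<Longrightarrow> u \<parallel> v \<Longrightarrow> emeasure M (Q u \<inter> Q v) = 0"
    and h: "h \<in> borel_measurable M"
    and big: "\<And>u. u \<in> U \<Longrightarrow> c * emeasure M (Q u) \<le> (\<integral>\<^sup>+x\<in>Q u. h x \<partial>M)"
  shows "c * emeasure M (\<Union>u\<in>U. Q u) \<le> (\<integral>\<^sup>+x\<in>(\<Union>u\<in>U. Q u). h x \<partial>M)"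
proof -
  define V where "V = {u\<in>U. \<forall>v\<in>U. \<not> strict_prefix v u}"
  have VU: "V \<subseteq> U" by (auto simp: V_def)
  have "\<exists>v\<in>V. prefix v u" if "u \<in> U" for u
    using that
  proof (induction u rule: length_induct)
    case (1 u)
    show ?case
    proof (cases "u \<in> V")
      case False
      then obtain v where "v \<in> U" "strict_prefix v u" using 1(2) by (auto simp: V_def)
      moreover from this obtain v' where "v' \<in> V" "prefix v' v"
        using 1(1) prefix_length_less by blast
      ultimately show ?thesis by (meson prefix_order.trans strict_prefix_def)
    qed auto
  qed
  then have "Q u \<subseteq> (\<Union>v\<in>V. Q v)" if "u \<in> U" for u
    using nested VU that by (meson SUP_upper2 subsetD)
  then have UV: "(\<Union>u\<in>U. Q u) = (\<Union>u\<in>V. Q u)"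
    using VU by blast
  have null': "emeasure M (Q u \<inter> Q v) = 0" if "u \<in> V" "v \<in> V" "u \<noteq> v" for u v
    using that VU by (intro null) (auto simp: V_def strict_prefix_def parallel_def)
  have dec: "(\<integral>\<^sup>+x\<in>(\<Union>u\<in>V. Q u). h' x \<partial>M) = (\<integral>\<^sup>+u. (\<integral>\<^sup>+x\<in>Q u. h' x \<partial>M) \<partial>count_space V)"
    if "h' \<in> borel_measurable M" for h'
    using VU Q null' that by (intro nn_integral_UN_almost_disjoint) auto
  have ems: "(\<integral>\<^sup>+x\<in>A. c \<partial>M) = c * emeasure M A" if "A \<in> sets M" for A
    using that by (rule nn_integral_cmult_indicator)
  have UQ: "(\<Union>u\<in>V. Q u) \<in> sets M"
    using VU Q by (intro sets.countable_UN') auto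
  have "c * emeasure M (\<Union>u\<in>V. Q u) = (\<integral>\<^sup>+u. (\<integral>\<^sup>+x\<in>Q u. c \<partial>M) \<partial>count_space V)"
    using dec[of "\<lambda>_. c"] ems[OF UQ] by simp
  also have "\<dots> \<le> (\<integral>\<^sup>+u. (\<integral>\<^sup>+x\<in>Q u. h x \<partial>M) \<partial>count_space V)"
    by (rule nn_integral_mono) (use VU Q big in \<open>auto simp: ems\<close>)
  also have "\<dots> = (\<integral>\<^sup>+x\<in>(\<Union>u\<in>V. Q u). h x \<partial>M)"
    using dec[OF h] by simp
  finally show ?thesis unfolding UV .
qed

section \<open>Cubes and measures of self-similar sets\<close>

lemma word_map_simps [simp]:
  "word_map S [] = id" "word_map S (i # u) = S i \<circ> word_map S u"
  by (auto simp: word_map_def)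

lemma basic_cube_Nil [simp]: "basic_cube S K [] = K"
  by (simp add: basic_cube_def)

lemma basic_cube_Cons: "basic_cube S K (i # u) = S i ` basic_cube S K u"
  by (simp add: basic_cube_def image_comp)

lemma basic_cube_append: "basic_cube S K (u @ v) = word_map S u ` basic_cube S K v"
  by (induction u) (auto simp: basic_cube_Cons image_comp)

text \<open>
  The rotations and translations enter the argument only through the scaling of distances, so
  the geometric part is done in an arbitrary metric space.
\<close>

locale similarity_system =
  fixes m :: nat and r :: "nat \<Rightarrow> real" and S :: "nat \<Rightarrow> 'a::metric_space \<Rightarrow> 'a" and K :: "'a set"
  assumes ratio: "i \<in> {1..m} \<Longrightarrow> 0 < r i \<and> r i < 1"
    and dist_S: "i \<in> {1..m} \<Longrightarrow> dist (S i x) (S i y) = r i * dist x y"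
    and no_common_fixed_point: "\<nexists>x. \<forall>i\<in>{1..m}. S i x = x"
    and K: "self_similar_set m S K"
begin

lemma K_nonempty: "K \<noteq> {}"
  and compact_K: "compact K"
  and K_eq: "K = (\<Union>i\<in>{1..m}. S i ` K)"
  using K unfolding self_similar_set_def by blast+

lemma letters_nonempty: "{1..m} \<noteq> {}"
proof
  assume "{1..m} = {}"
  then have "K = {}" using K_eq by (simp only: SUP_empty)
  then show False using K_nonempty by simp
qed

lemma inj_S: "i \<in> {1..m} \<Longrightarrow> inj (S i)"
  by (rule injI) (metis dist_S dist_eq_0_iff mult_eq_0_iff ratio less_irrefl)

lemma continuous_on_S: "i \<in> {1..m} \<Longrightarrow> continuous_on A (S i)"
  by (rule lipschitz_on_continuous_on[of "r i"])
     (use ratio in \<open>auto simp: lipschitz_on_def dist_S less_imp_le\<close>)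

lemma inj_word_map: "set u \<subseteq> {1..m} \<Longrightarrow> inj (word_map S u)"
  by (induction u) (auto intro!: inj_compose inj_S)

lemma compact_basic_cube: "set u \<subseteq> {1..m} \<Longrightarrow> compact (basic_cube S K u)"
  by (induction u)
     (auto simp: basic_cube_Cons compact_K intro!: compact_continuous_image continuous_on_S)

lemma basic_cube_subset: "set u \<subseteq> {1..m} \<Longrightarrow> basic_cube S K u \<subseteq> K"
proof (induction u)
  case (Cons i u)
  then have "S i ` basic_cube S K u \<subseteq> S i ` K" "i \<in> {1..m}" by auto
  then show ?case unfolding basic_cube_Cons using K_eq by blast
qed simp

lemma basic_cube_antimono:
  assumes "prefix u v" "set v \<subseteq> {1..m}"
  shows "basic_cube S K v \<subseteq> basic_cube S K u"
proof -
  obtain z where z: "v = u @ z" using assms(1) by (auto simp: prefix_def)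
  then have "basic_cube S K z \<subseteq> K" using assms(2) by (intro basic_cube_subset) auto
  then show ?thesis unfolding z basic_cube_append by (auto simp: basic_cube_def)
qed

text \<open>
  Suppose some point has positive mass and let \<open>A\<close> be the set of points of maximal mass \<open>c\<close>. It is
  finite, as the total mass is \<open>1\<close>. The mass \<open>c\<close> of a point of \<open>A\<close> is the average, with
  positive weights, of the masses of its preimages under the injective maps \<open>S i\<close>, none of which
  exceeds \<open>c\<close>; so each preimage is again a point of \<open>A\<close>. Hence \<open>A \<subseteq> S i ` A\<close>. As \<open>S i\<close>
  shrinks distances, \<open>A\<close> has diameter \<open>0\<close>, and its only point is fixed by every \<open>S i\<close>.
\<close>

lemma self_similar_measure_atomless:
  assumes w: "\<And>i. i \<in> {1..m} \<Longrightarrow> 0 < w i" "(\<Sum>i=1..m. w i) = 1"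
    and \<mu>: "self_similar_measure m S w \<mu>"
  shows "emeasure \<mu> {x} = 0"
proof (rule ccontr)
  interpret prob_space \<mu> using \<mu> by (simp add: self_similar_measure_def)
  have sets: "sets \<mu> = sets borel" using \<mu> by (simp add: self_similar_measure_def)
  have self: "measure \<mu> {x} = (\<Sum>i=1..m. w i * measure \<mu> (S i -` {x}))" for x
  proof -
    have "ennreal (measure \<mu> {x}) = (\<Sum>i=1..m. ennreal (w i) * ennreal (measure \<mu> (S i -` {x})))"
      using \<mu> by (simp add: self_similar_measure_def emeasure_eq_measure[symmetric])
    also have "\<dots> = (\<Sum>i=1..m. ennreal (w i * measure \<mu> (S i -` {x})))"
      using w(1) by (intro sum.cong refl ennreal_mult'[symmetric]) (simp add: less_imp_le)
    also have "\<dots> = ennreal (\<Sum>i=1..m. w i * measure \<mu> (S i -` {x}))"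
      using w(1) by (intro sum_ennreal) (simp add: less_imp_le)
    finally show ?thesis
      using w(1) by (subst (asm) ennreal_inj) (auto intro!: sum_nonneg simp: less_imp_le)
  qed
  assume "emeasure \<mu> {x} \<noteq> 0"
  \<comment> \<open>The set \<open>B\<close> of points at least as heavy as \<open>x\<close> is finite, so the maximal mass \<open>c\<close> is attained.\<close>
  define c0 where "c0 = measure \<mu> {x}"
  have c0: "0 < c0"
    using \<open>emeasure \<mu> {x} \<noteq> 0\<close> by (simp add: c0_def emeasure_eq_measure zero_less_measure_iff)
  define B where "B = {y. c0 \<le> measure \<mu> {y}}"
  have "finite B \<and> card B \<le> nat \<lfloor>1 / c0\<rfloor>"
  proof (rule finite_if_finite_subsets_card_bdd)
    fix G assume G: "G \<subseteq> B" "finite G"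
    have "real (card G) * c0 \<le> (\<Sum>y\<in>G. measure \<mu> {y})"
      using G by (intro sum_bounded_below) (auto simp: B_def)
    also have "\<dots> = measure \<mu> G"
      using G by (intro finite_measure_eq_sum_singleton[symmetric]) (auto simp: sets)
    also have "\<dots> \<le> 1" by simp
    finally show "card G \<le> nat \<lfloor>1 / c0\<rfloor>" using c0 by (simp add: field_simps le_nat_floor)
  qed
  then have B: "finite B" ..
  have xB: "x \<in> B" by (simp add: B_def c0_def)
  define c where "c = Max ((\<lambda>y. measure \<mu> {y}) ` B)"
  have c_ge: "measure \<mu> {y} \<le> c" if "y \<in> B" for y
    unfolding c_def using B that by (intro Max_ge) auto
  have c0c: "c0 \<le> c" using c_ge[OF xB] by (simp add: c0_def)
  have c: "measure \<mu> {y} \<le> c" for y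
    using c_ge[of y] c0c by (cases "y \<in> B") (auto simp: B_def)
  define A where "A = {y. measure \<mu> {y} = c}"
  have "A \<subseteq> B" using c0c by (auto simp: A_def B_def)
  then have A: "finite A" using B by (rule finite_subset)
  have "c \<in> (\<lambda>y. measure \<mu> {y}) ` B"
    unfolding c_def using B xB by (intro Max_in) auto
  then have A_ne: "A \<noteq> {}" by (auto simp: A_def)
  have preimage: "\<exists>z\<in>A. S i z = y" if i: "i \<in> {1..m}" and y: "y \<in> A" for i y
  proof -
    \<comment> \<open>A preimage is empty or a single point; the empty case is excluded below, since its mass would be \<open>0\<close>.\<close>
    have pre: "S j -` {y} = {} \<or> (\<exists>z. S j z = y \<and> S j -` {y} = {z})" if "j \<in> {1..m}" for j
      using inj_S[OF that] by (auto simp: inj_def)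
    have le: "measure \<mu> (S j -` {y}) \<le> c" if "j \<in> {1..m}" for j
      using pre[OF that] c c0 c0c by auto
    \<comment> \<open>The nonnegative deficits from \<open>c\<close> have weighted sum \<open>0\<close>, so each of them vanishes.\<close>
    have "(\<Sum>j=1..m. w j * (c - measure \<mu> (S j -` {y}))) = (\<Sum>j=1..m. w j) * c - measure \<mu> {y}"
      by (simp add: self[of y] right_diff_distrib sum_subtractf sum_distrib_right)
    also have "\<dots> = 0" using y w(2) by (simp add: A_def)
    finally have "w i * (c - measure \<mu> (S i -` {y})) = 0"
      using i w(1) le by (subst (asm) sum_nonneg_eq_0_iff) (auto simp: less_imp_le)
    then have "measure \<mu> (S i -` {y}) = c" using w(1)[OF i] by simp
    then show ?thesis using pre[OF i] c0 c0c by (auto simp: A_def)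
  qed
  obtain i where i: "i \<in> {1..m}" using letters_nonempty by blast
  have "dist a a' = 0" if "a \<in> A" "a' \<in> A" for a a'
  proof -
    \<comment> \<open>A pair realising the diameter \<open>d\<close> of \<open>A\<close> is the image of a pair at distance at most \<open>d\<close>.\<close>
    define d where "d = Max ((\<lambda>(a, a'). dist a a') ` (A \<times> A))"
    have "d \<in> (\<lambda>(a, a'). dist a a') ` (A \<times> A)"
      unfolding d_def using A A_ne by (intro Max_in) auto
    then obtain a1 a2 where a12: "a1 \<in> A" "a2 \<in> A" "d = dist a1 a2" by auto
    have d: "dist a a' \<le> d" if "a \<in> A" "a' \<in> A" for a a'
      unfolding d_def using A that by (intro Max_ge) auto
    obtain b1 b2 where b: "b1 \<in> A" "S i b1 = a1" "b2 \<in> A" "S i b2 = a2"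
      using preimage[OF i] a12 by metis
    have "d = r i * dist b1 b2" using dist_S[OF i] b a12 by metis
    also have "\<dots> \<le> r i * d" using ratio[OF i] d b by (intro mult_left_mono) auto
    finally have "d * (1 - r i) \<le> 0" by (simp add: algebra_simps)
    then have "d \<le> 0" using ratio[OF i] by (simp add: mult_le_0_iff)
    then show ?thesis using d[OF that] zero_le_dist[of a a'] by linarith
  qed
  then have "\<forall>i\<in>{1..m}. S i a = a" if "a \<in> A" for a
    using preimage that by (metis dist_eq_0_iff)
  then show False using A_ne no_common_fixed_point by blast
qed

text \<open>
  Choose a letter \<open>i\<close> and a point \<open>z\<close> of \<open>K\<close> with \<open>x = S i z\<close>, and continue with \<open>z\<close>. The letters
  chosen form the code.
\<close>

lemma exists_code:
  assumes "x \<in> K"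
  shows "\<exists>\<omega>\<in>streams {1..m}. \<forall>n. x \<in> basic_cube S K (stake n \<omega>)"
proof -
  have "\<forall>y\<in>K. \<exists>iz. fst iz \<in> {1..m} \<and> snd iz \<in> K \<and> S (fst iz) (snd iz) = y"
  proof
    fix y assume "y \<in> K"
    then obtain i z where "i \<in> {1..m}" "z \<in> K" "y = S i z" using K_eq by blast
    then show "\<exists>iz. fst iz \<in> {1..m} \<and> snd iz \<in> K \<and> S (fst iz) (snd iz) = y"
      by (intro exI[of _ "(i, z)"]) simp
  qed
  then obtain step where step: "\<And>y. y \<in> K \<Longrightarrow>
      fst (step y) \<in> {1..m} \<and> snd (step y) \<in> K \<and> S (fst (step y)) (snd (step y)) = y"
    by metis
  define code where "code y = smap (fst \<circ> step) (siterate (snd \<circ> step) y)" for y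
  have code: "code y = fst (step y) ## code (snd (step y))" for y
    unfolding code_def by (subst siterate.code) simp
  have "y \<in> basic_cube S K (stake n (code y))" if "y \<in> K" for n y
    using that
  proof (induction n arbitrary: y)
    case (Suc n)
    then have "snd (step y) \<in> basic_cube S K (stake n (code (snd (step y))))"
      using step by blast
    then have "S (fst (step y)) (snd (step y)) \<in> basic_cube S K (stake (Suc n) (code y))"
      by (subst code) (auto simp: basic_cube_Cons)
    then show ?case using step Suc.prems by simp
  qed simp
  moreover have "code y \<in> streams {1..m}" if "y \<in> K" for y
    using that
  proof (coinduction arbitrary: y)
    case streams
    then show ?case using step[of y] code[of y] by (metis)
  qed
  ultimately show ?thesis using assms by blast
qed

text \<open>
  The cubes along an infinite word have diameters bounded by a geometric sequence, so a point
  common to all of them is unique.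
\<close>

lemma coding_map_eqI:
  assumes \<omega>: "\<omega> \<in> streams {1..m}" and x: "\<And>n. x \<in> basic_cube S K (stake n \<omega>)"
  shows "coding_map S K \<omega> = x"
proof -
  define \<rho> where "\<rho> = Max (r ` {1..m})"
  have "\<rho> \<in> r ` {1..m}" unfolding \<rho>_def using letters_nonempty by (intro Max_in) auto
  then have \<rho>: "0 < \<rho>" "\<rho> < 1" using ratio by auto
  have r\<rho>: "r i \<le> \<rho>" if "i \<in> {1..m}" for i unfolding \<rho>_def using that by (intro Max_ge) auto
  have diam: "dist y z \<le> \<rho> ^ length u * diameter K"
    if "set u \<subseteq> {1..m}" "y \<in> basic_cube S K u" "z \<in> basic_cube S K u" for u y z
    using that
  proof (induction u arbitrary: y z)
    case Nil
    then show ?case using diameter_bounded_bound[OF compact_imp_bounded[OF compact_K]] by simp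
  next
    case (Cons i u)
    then obtain y' z' where yz: "y' \<in> basic_cube S K u" "y = S i y'" "z' \<in> basic_cube S K u" "z = S i z'"
      by (auto simp: basic_cube_Cons)
    have i: "i \<in> {1..m}" using Cons by simp
    have "dist y z = r i * dist y' z'" using yz i by (simp add: dist_S)
    also have "\<dots> \<le> \<rho> * (\<rho> ^ length u * diameter K)"
      using Cons yz i r\<rho> \<rho> by (intro mult_mono) auto
    finally show ?case by simp
  qed
  have stake: "set (stake n \<omega>) \<subseteq> {1..m}" for n
    using \<omega> sset_shift[of "stake n \<omega>" "sdrop n \<omega>"] by (auto simp: streams_iff_sset stake_sdrop)
  have "y = x" if y: "\<And>n. 1 \<le> n \<Longrightarrow> y \<in> basic_cube S K (stake n \<omega>)" for y
  proof -
    have "(\<lambda>n. \<rho> ^ n * diameter K) \<longlonglongrightarrow> 0 * diameter K"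
      using \<rho> by (intro tendsto_mult_right LIMSEQ_realpow_zero) auto
    moreover have "\<forall>\<^sub>F n in sequentially. dist y x \<le> \<rho> ^ n * diameter K"
      using eventually_ge_at_top[of 1]
      by eventually_elim (use diam[OF stake y x] in simp)
    ultimately have "dist y x \<le> 0 * diameter K"
      by (intro tendsto_lowerbound) auto
    then show ?thesis by simp
  qed
  then have "(\<Inter>n\<in>{1..}. basic_cube S K (stake n \<omega>)) = {x}"
    using x by auto
  then show ?thesis by (simp add: coding_map_def)
qed

text \<open>
  The first shifts of the critical words are among the post-critical words, hence finite in number;
  restoring the first letter leaves \<open>m\<close> choices for each. Every critical point has a code, and
  that code is a critical word.
\<close>

lemma finite_critical_points:
  assumes "post_critically_finite m S K"
  shows "finite (critical_points m S K)"
proof -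
  let ?C = "critical_set m S K"
  have "(stl ^^ 1) ` ?C \<subseteq> (\<Union>n\<in>{1..}. (stl ^^ n) ` ?C)"
    by (rule UN_upper) simp
  then have "finite (stl ` ?C)"
    using assms unfolding post_critically_finite_def by (auto dest: finite_subset)
  moreover have "?C \<subseteq> (\<lambda>(i, s). i ## s) ` ({1..m} \<times> stl ` ?C)"
  proof
    fix \<omega> assume \<omega>: "\<omega> \<in> ?C"
    then have "shd \<omega> \<in> {1..m}"
      by (auto simp: critical_set_def streams_iff_sset dest!: shd_sset[THEN subsetD[rotated]])
    then show "\<omega> \<in> (\<lambda>(i, s). i ## s) ` ({1..m} \<times> stl ` ?C)"
      using \<omega> by (intro image_eqI[of _ _ "(shd \<omega>, stl \<omega>)"]) auto
  qed
  ultimately have "finite ?C" by (meson finite_SigmaI finite_atLeastAtMost finite_imageI finite_subset)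
  moreover have "critical_points m S K \<subseteq> coding_map S K ` ?C"
  proof
    fix x assume x: "x \<in> critical_points m S K"
    then have "x \<in> K" using K_eq by (auto simp: critical_points_def)
    then obtain \<omega> where \<omega>: "\<omega> \<in> streams {1..m}" "\<And>n. x \<in> basic_cube S K (stake n \<omega>)"
      using exists_code by blast
    then have "coding_map S K \<omega> = x" by (rule coding_map_eqI)
    then show "x \<in> coding_map S K ` ?C"
      using x \<omega>(1) by (auto simp: critical_set_def intro!: image_eqI[of _ _ \<omega>])
  qed
  ultimately show ?thesis by (meson finite_imageI finite_subset)
qed

text \<open>
  Remove the longest common prefix \<open>a\<close>. What remains starts with different letters
  \<open>i\<close> and \<open>j\<close>, so the two cubes lie in \<open>S i ` K\<close> and \<open>S j ` K\<close>, which meet in critical points. As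
  \<^term>\<open>word_map S a\<close> is injective, it maps this intersection onto the intersection of the images.
\<close>

lemma finite_parallel_cubes_inter:
  assumes "post_critically_finite m S K" "set u \<subseteq> {1..m}" "set v \<subseteq> {1..m}" "u \<parallel> v"
  shows "finite (basic_cube S K u \<inter> basic_cube S K v)"
proof -
  obtain a i u' j v' where uv: "i \<noteq> j" "u = a @ i # u'" "v = a @ j # v'"
    using parallel_decomp[OF assms(4)] by blast
  have ij: "i \<in> {1..m}" "j \<in> {1..m}" using assms uv by auto
  have sub: "basic_cube S K (a @ k # z) \<subseteq> word_map S a ` S k ` K" if "set z \<subseteq> {1..m}" for k z
    using basic_cube_subset[OF that] by (auto simp: basic_cube_append basic_cube_Cons)
  have "basic_cube S K u \<inter> basic_cube S K v \<subseteq> word_map S a ` S i ` K \<inter> word_map S a ` S j ` K"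
    using assms uv sub[of u' i] sub[of v' j] by auto
  also have "\<dots> = word_map S a ` (S i ` K \<inter> S j ` K)"
    using inj_word_map[of a] assms uv by (auto intro!: image_Int[symmetric])
  also have "\<dots> \<subseteq> word_map S a ` critical_points m S K"
    using ij uv(1) unfolding critical_points_def by (intro image_mono) blast
  finally show ?thesis
    using finite_critical_points[OF assms(1)] by (meson finite_imageI finite_subset)
qed

end

section \<open>The maximal operator\<close>

lemma cube_maximal_level_set:
  "{x. t < cube_maximal m S K \<mu> f x} =
     (\<Union>u\<in>{u. u \<noteq> [] \<and> set u \<subseteq> {1..m} \<and>
             t < (\<integral>\<^sup>+y\<in>basic_cube S K u. ennreal \<bar>f y\<bar> \<partial>\<mu>) / emeasure \<mu> (basic_cube S K u)}.
        basic_cube S K u)"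
proof -
  have "(\<exists>n\<ge>1. u \<in> words m n) \<longleftrightarrow> u \<noteq> [] \<and> set u \<subseteq> {1..m}" for u
    by (auto simp: words_def Suc_le_eq)
  then show ?thesis by (auto simp: cube_maximal_def less_SUP_iff)
qed

text \<open>
  If \<open>b = 0\<close> the conclusion is trivial, so a cube of measure zero causes no difficulty.
\<close>

lemma ennreal_less_divideD:
  fixes a b t :: ennreal
  assumes "t < a / b" "b \<noteq> \<top>"
  shows "t * b \<le> a"
proof (cases "b = 0")
  case False
  have "t * b \<le> a / b * b" using assms by (intro mult_right_mono) auto
  also have "a / b * b = a" using False assms by (simp add: ennreal_divide_times ennreal_divide_self top.not_eq_extremum)
  finally show ?thesis .
qed simp

proposition (in similarity_system) cube_maximal_strong_type:
  assumes w: "\<And>i. i \<in> {1..m} \<Longrightarrow> 0 < w i" "(\<Sum>i=1..m. w i) = 1"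
    and \<mu>: "self_similar_measure m S w \<mu>"
    and pcf: "post_critically_finite m S K"
    and p: "1 < p"
    and f: "set_borel_measurable \<mu> K f"
  shows "(\<integral>\<^sup>+x\<in>K. ennreal_powr (cube_maximal m S K \<mu> f x) p \<partial>\<mu>)
           \<le> ennreal (2 powr p * p / (p - 1)) * (\<integral>\<^sup>+x\<in>K. ennreal (\<bar>f x\<bar> powr p) \<partial>\<mu>)"
proof -
  interpret prob_space \<mu> using \<mu> by (simp add: self_similar_measure_def)
  have sets: "sets \<mu> = sets borel" using \<mu> by (simp add: self_similar_measure_def)
  then have space: "space \<mu> = UNIV" using sets_eq_imp_space_eq by fastforce
  let ?Q = "basic_cube S K" and ?F = "cube_maximal m S K \<mu> f"
  \<comment> \<open>Extending \<open>|f|\<close> by \<open>0\<close> makes it measurable everywhere and changes no average, since all cubes lie in \<open>K\<close>.\<close>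
  define g where "g x = \<bar>indicator K x *\<^sub>R f x\<bar>" for x
  have g [measurable]: "g \<in> borel_measurable \<mu>"
    using f unfolding g_def set_borel_measurable_def by measurable
  have g_nonneg: "0 \<le> g x" for x by (simp add: g_def)
  have Q: "?Q u \<in> sets \<mu>" if "set u \<subseteq> {1..m}" for u
    using compact_basic_cube[OF that] by (simp add: sets borel_compact)
  have null: "emeasure \<mu> (?Q u \<inter> ?Q v) = 0" if "set u \<subseteq> {1..m}" "set v \<subseteq> {1..m}" "u \<parallel> v" for u v
  proof -
    have "emeasure \<mu> (?Q u \<inter> ?Q v) = (\<Sum>x\<in>?Q u \<inter> ?Q v. emeasure \<mu> {x})"
      using finite_parallel_cubes_inter[OF pcf that]
      by (intro emeasure_eq_sum_singleton) (auto simp: sets)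
    moreover have "emeasure \<mu> {x} = 0" for x
      by (rule self_similar_measure_atomless) (fact w \<mu>)+
    ultimately show ?thesis by simp
  qed
  have weak: "t * emeasure \<mu> {x. t < ?F x} \<le> (\<integral>\<^sup>+x\<in>{x. t < ?F x}. ennreal (g x) \<partial>\<mu>)" for t
    unfolding cube_maximal_level_set
  proof (rule nested_family_weak_type, goal_cases)
    case (5 u)
    have "(\<integral>\<^sup>+x\<in>?Q u. ennreal \<bar>f x\<bar> \<partial>\<mu>) = (\<integral>\<^sup>+x\<in>?Q u. ennreal (g x) \<partial>\<mu>)"
      using 5 basic_cube_subset[of u] by (intro nn_integral_cong) (auto simp: g_def indicator_def)
    then show ?case using 5 by (auto intro!: ennreal_less_divideD)
  qed (use Q null basic_cube_antimono in auto)
  have "{x. t < ?F x} \<in> sets \<mu>" for t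
    unfolding cube_maximal_level_set using Q by (intro sets.countable_UN') auto
  then have [measurable]: "?F \<in> borel_measurable \<mu>"
    by (intro borel_measurableI_greater) (auto simp: space)
  have "(\<integral>\<^sup>+x\<in>K. ennreal_powr (?F x) p \<partial>\<mu>) \<le> (\<integral>\<^sup>+x. ennreal_powr (?F x) p \<partial>\<mu>)"
    by (intro nn_integral_mono) (auto simp: indicator_def)
  also have "\<dots> \<le> ennreal (2 powr p * p / (p - 1)) * (\<integral>\<^sup>+x. ennreal (g x powr p) \<partial>\<mu>)"
    using p weak g by (intro strong_type_from_weak_type) (simp_all add: space g_nonneg)
  also have "(\<integral>\<^sup>+x. ennreal (g x powr p) \<partial>\<mu>) = (\<integral>\<^sup>+x\<in>K. ennreal (\<bar>f x\<bar> powr p) \<partial>\<mu>)"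
    using p by (intro nn_integral_cong) (auto simp: g_def indicator_def)
  finally show ?thesis .
qed

theorem corollary1p4:
  fixes m :: nat
    and r :: "nat \<Rightarrow> real"
    and R :: "nat \<Rightarrow> real ^ 'd \<Rightarrow> real ^ 'd"
    and b :: "nat \<Rightarrow> real ^ 'd"
    and S :: "nat \<Rightarrow> real ^ 'd \<Rightarrow> real ^ 'd"
    and K :: "(real ^ 'd) set"
    and w :: "nat \<Rightarrow> real"
    and \<mu> :: "(real ^ 'd) measure"
    and p :: real
    and f :: "real ^ 'd \<Rightarrow> real"
  assumes "\<And>i. i \<in> {1..m} \<Longrightarrow> 0 < r i \<and> r i < 1"
    and "\<And>i. i \<in> {1..m} \<Longrightarrow> orthogonal_transformation (R i)"
    and "\<And>i x. i \<in> {1..m} \<Longrightarrow> S i x = r i *\<^sub>R R i x + b i"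
    and "\<nexists>x. \<forall>i\<in>{1..m}. S i x = x"
    and "self_similar_set m S K"
    and "\<And>i. i \<in> {1..m} \<Longrightarrow> 0 < w i"
    and "(\<Sum>i=1..m. w i) = 1"
    and "self_similar_measure m S w \<mu>"
    and "post_critically_finite m S K"
    and "1 < p"
    and "f \<in> Lp_on p K \<mu>"
  shows "(\<integral>\<^sup>+x\<in>K. ennreal_powr (cube_maximal m S K \<mu> f x) p \<partial>\<mu>)
           \<le> ennreal (2 powr (p + 2) * p / (p - 1)) * (\<integral>\<^sup>+x\<in>K. ennreal (\<bar>f x\<bar> powr p) \<partial>\<mu>)"
proof -
  have similarity: "dist (S i x) (S i y) = r i * dist x y" if "i \<in> {1..m}" for i x y
  proof -
    have "S i x - S i y = r i *\<^sub>R R i (x - y)"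
      using assms(2)[OF that] assms(3)[OF that]
      by (simp add: orthogonal_transformation_def linear_diff scaleR_diff_right)
    then show ?thesis
      using assms(1,2)[OF that] by (simp add: dist_norm orthogonal_transformation_norm)
  qed
  interpret similarity_system m r S K
    by unfold_locales (fact assms(1) similarity assms(4,5))+
  have "(\<integral>\<^sup>+x\<in>K. ennreal_powr (cube_maximal m S K \<mu> f x) p \<partial>\<mu>)
      \<le> ennreal (2 powr p * p / (p - 1)) * (\<integral>\<^sup>+x\<in>K. ennreal (\<bar>f x\<bar> powr p) \<partial>\<mu>)"
    using assms(6-11) by (intro cube_maximal_strong_type) (auto simp: Lp_on_def)
  also have "\<dots> \<le> ennreal (2 powr (p + 2) * p / (p - 1)) * (\<integral>\<^sup>+x\<in>K. ennreal (\<bar>f x\<bar> powr p) \<partial>\<mu>)"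
    using assms(10)
    by (intro mult_right_mono ennreal_leI divide_right_mono) (auto simp: powr_add)
  finally show ?thesis .
qed
end
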